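(* Let $n>1$ and let $R$ be a commutative ring with $1\ne0$. Then: (1) there is an embedding (injective monoid homomorphism) $\mathcal{MP}(R_n)\hookrightarrow\mathcal{MT}_{n+1}(R)$; (2) whenever $R$ is finite, there is an embedding (injective group homomorphism) $\mathcal{P}(R_n)\hookrightarrow\pi_{n+1}(\mathcal{MT}_{n+1}(R))$.
   Context: $R_n=R[\alpha_1,\ldots,\alpha_n]$ is the ring of dual numbers in $n$ variables over $R$: the quotient of $R[x_1,\ldots,x_n]$ by the ideal generated by all $x_ix_j$, $1\le i,j\le n$, i.e. the free commutative $R$-algebra with basis $1,\alpha_1,\ldots,\alpha_n$ and $\alpha_i\alpha_j=0$ for all $i,j$. For a commutative ring $S$, $\mathcal{MP}(S)$ is the monoid under composition of polynomials $f\in S[x]$ inducing a bijection of $S$; for $S$ finite, $\mathcal{P}(S)$ is the group of permutations of $S$ induced by such polynomials. A polynomial $g\in R[x_1,\ldots,x_k]$ is unit-valued if $g(a)\in R^\times$ for all $a\in R^k$. For $m>1$, $\mathcal{MT}_m(R)$ is the monoid, under composition $\vec f\circ\vec g=(f_1(\vec g),\ldots,f_m(\vec g))$, of all tuples $(f_1,f_2+x_2u_2,\ldots,f_m+x_mu_m)$ with $f_1\in R[x_1]$ inducing a bijection of $R$ and, for $2\le i\le m$, $f_i,u_i\in R[x_1,\ldots,x_{i-1}]$ with $u_i$ unit-valued. $\pi_m$ sends an $m$-tuple of polynomials in $R[x_1,\ldots,x_m]$ to the function $R^m\to R^m$ it induces; for $R$ finite, $\pi_m(\mathcal{MT}_m(R))$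 is a group of permutations of $R^m$. *)

theory Defs
  imports
    "HOL-Library.Poly_Mapping"
    "HOL-Library.FuncSet"
    "HOL-Library.Cardinality"
    "HOL-Computational_Algebra.Polynomial"
    "HOL-Algebra.Bij"
begin

section \<open>Dual numbers in several variables\<close>

text \<open>
  For a finite index type \<open>'n\<close> with \<open>n\<close> elements, \<open>('a, 'n) dual_number\<close> is the free module over
  the ring \<open>'a\<close> with basis \<open>1\<close> and the \<open>\<alpha>\<^sub>i\<close> for \<open>i :: 'n\<close>, multiplied according to
  \<open>\<alpha>\<^sub>i * \<alpha>\<^sub>j = 0\<close>; \<open>Dual a b\<close> stands for \<open>a + (\<Sum>i. b i * \<alpha>\<^sub>i)\<close>.
\<close>

datatype ('a, 'n) dual_number = Dual (dual_const: 'a) (dual_coeff: "'n \<Rightarrow> 'a")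

instantiation dual_number :: (comm_ring_1, type) comm_ring_1
begin

definition zero_dual_number :: "('a, 'b) dual_number"
  where "0 = Dual 0 (\<lambda>_. 0)"

definition one_dual_number :: "('a, 'b) dual_number"
  where "1 = Dual 1 (\<lambda>_. 0)"

definition plus_dual_number ::
    "('a, 'b) dual_number \<Rightarrow> ('a, 'b) dual_number \<Rightarrow> ('a, 'b) dual_number"
  where "x + y = Dual (dual_const x + dual_const y) (\<lambda>i. dual_coeff x i + dual_coeff y i)"

definition uminus_dual_number :: "('a, 'b) dual_number \<Rightarrow> ('a, 'b) dual_number"
  where "- x = Dual (- dual_const x) (\<lambda>i. - dual_coeff x i)"

definition minus_dual_number ::
    "('a, 'b) dual_number \<Rightarrow> ('a, 'b) dual_number \<Rightarrow> ('a, 'b) dual_number"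
  where "x - y = Dual (dual_const x - dual_const y) (\<lambda>i. dual_coeff x i - dual_coeff y i)"

definition times_dual_number ::
    "('a, 'b) dual_number \<Rightarrow> ('a, 'b) dual_number \<Rightarrow> ('a, 'b) dual_number"
  where "x * y = Dual (dual_const x * dual_const y)
    (\<lambda>i. dual_const x * dual_coeff y i + dual_coeff x i * dual_const y)"

instance
  by standard
    (auto simp: zero_dual_number_def one_dual_number_def plus_dual_number_def
      uminus_dual_number_def minus_dual_number_def times_dual_number_def algebra_simps
      intro!: dual_number.expand)

end

definition dual_of :: "'a::comm_ring_1 \<Rightarrow> ('a, 'n) dual_number"
  where "dual_of a = Dual a (\<lambda>_. 0)"

definition dual_alpha :: "'n \<Rightarrow> ('a::comm_ring_1, 'n) dual_number"
  where "dual_alpha i = Dual 0 (\<lambda>j. if j = i then 1 else 0)"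

lemma dual_of_hom:
  "dual_of 0 = 0" "dual_of 1 = 1"
  "dual_of (a + b) = dual_of a + dual_of b" "dual_of (a * b) = dual_of a * dual_of b"
  by (simp_all add: dual_of_def zero_dual_number_def one_dual_number_def plus_dual_number_def
      times_dual_number_def)

lemma dual_alpha_mult: "dual_alpha i * dual_alpha j = 0"
  by (simp add: dual_alpha_def times_dual_number_def zero_dual_number_def)

lemma Dual_eq_sum:
  fixes a :: "'a::comm_ring_1" and b :: "'n::finite \<Rightarrow> 'a"
  shows "Dual a b = dual_of a + (\<Sum>i\<in>UNIV. dual_of (b i) * dual_alpha i)"
proof -
  have sum_Dual: "(\<Sum>i\<in>A. Dual (0::'a) (f i)) = Dual 0 (\<lambda>j. \<Sum>i\<in>A. f i j)"
    if "finite A" for A :: "'n set" and f :: "'n \<Rightarrow> 'n \<Rightarrow> 'a"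
    using that by (induction A) (simp_all add: zero_dual_number_def plus_dual_number_def)
  have "dual_of (b i) * dual_alpha i = Dual 0 (\<lambda>j. if j = i then b i else 0)" for i
    by (auto simp: dual_of_def dual_alpha_def times_dual_number_def)
  then show ?thesis
    by (simp add: sum_Dual dual_of_def plus_dual_number_def)
qed


section \<open>Permutation polynomials in one variable\<close>

definition perm_poly_monoid :: "'s::comm_ring_1 poly monoid"  ("\<M>\<P>")
  where "\<M>\<P> =
    \<lparr>carrier = {f. bij (poly f)},
     mult = pcompose,
     one = [:0, 1:]\<rparr>"

text \<open>Only intended for finite \<open>'s\<close>; in general this is merely a monoid.\<close>

definition poly_perm_group :: "('s::comm_ring_1 \<Rightarrow> 's) monoid"  ("\<P>")
  where "\<P> = (BijGroup UNIV)\<lparr>carrier := poly ` {f :: 's poly. bij (poly f)}\<rparr>"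


section \<open>Polynomials in several variables\<close>

text \<open>
  Polynomials in the variables \<open>x\<^sub>0, x\<^sub>1, \<dots>\<close>: finitely supported maps from
  exponent vectors to coefficients, with the convolution product of \<^theory>\<open>HOL-Library.Poly_Mapping\<close>.
\<close>

type_synonym 'a mpoly = "(nat \<Rightarrow>\<^sub>0 nat) \<Rightarrow>\<^sub>0 'a"

definition mVar :: "nat \<Rightarrow> 'a::comm_ring_1 mpoly"
  where "mVar i = Poly_Mapping.single (Poly_Mapping.single i 1) 1"

definition mConst :: "'a::comm_ring_1 \<Rightarrow> 'a mpoly"
  where "mConst c = Poly_Mapping.single 0 c"

text \<open>The subring \<open>R[x\<^sub>1, \<dots>, x\<^sub>k]\<close>.\<close>

definition mpolys :: "nat \<Rightarrow> 'a::comm_ring_1 mpoly set"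
  where "mpolys k = {p. \<forall>e\<in>Poly_Mapping.keys p. Poly_Mapping.keys e \<subseteq> {1..k}}"

text \<open>Evaluation at \<open>v\<close>, with the coefficients transported along \<open>h\<close>.\<close>

definition meval_hom ::
    "('a \<Rightarrow> 'b) \<Rightarrow> (nat \<Rightarrow> 'b) \<Rightarrow> 'a::comm_ring_1 mpoly \<Rightarrow> 'b::comm_ring_1"
  where "meval_hom h v p = (\<Sum>e\<in>Poly_Mapping.keys p.
    h (Poly_Mapping.lookup p e) *
      (\<Prod>i\<in>Poly_Mapping.keys e. v i ^ Poly_Mapping.lookup e i))"

definition meval :: "(nat \<Rightarrow> 'a) \<Rightarrow> 'a::comm_ring_1 mpoly \<Rightarrow> 'a"
  where "meval = meval_hom (\<lambda>c. c)"

definition msubst :: "(nat \<Rightarrow> 'a mpoly) \<Rightarrow> 'a::comm_ring_1 mpoly \<Rightarrow> 'a mpoly"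
  where "msubst = meval_hom mConst"

text \<open>The set \<open>R\<^sup>k\<close>; tuples are indexed by \<open>{1..k}\<close> and extensional.\<close>

definition tuples :: "nat \<Rightarrow> (nat \<Rightarrow> 'a) set"
  where "tuples k = ({1..k} \<rightarrow>\<^sub>E UNIV)"

definition unit_valued :: "nat \<Rightarrow> 'a::comm_ring_1 mpoly \<Rightarrow> bool"
  where "unit_valued k g \<longleftrightarrow> (\<forall>a\<in>tuples k. meval a g dvd 1)"


section \<open>Triangular tuples of polynomials\<close>

definition triangular_tuples :: "nat \<Rightarrow> (nat \<Rightarrow> 'a::comm_ring_1 mpoly) set"
  where "triangular_tuples m = {F \<in> {1..m} \<rightarrow>\<^sub>E UNIV.
    F 1 \<in> mpolys 1 \<and> bij (\<lambda>t. meval (\<lambda>i\<in>{1}. t) (F 1)) \<and>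
    (\<forall>i\<in>{2..m}. \<exists>f\<in>mpolys (i - 1). \<exists>u\<in>mpolys (i - 1).
      unit_valued (i - 1) u \<and> F i = f + mVar i * u)}"

definition triangular_monoid :: "nat \<Rightarrow> (nat \<Rightarrow> 'a::comm_ring_1 mpoly) monoid"  ("\<M>\<T>")
  where "\<M>\<T> m =
    \<lparr>carrier = triangular_tuples m,
     mult = (\<lambda>F G. \<lambda>i\<in>{1..m}. msubst G (F i)),
     one = (\<lambda>i\<in>{1..m}. mVar i)\<rparr>"

definition induced_map ::
    "nat \<Rightarrow> (nat \<Rightarrow> 'a::comm_ring_1 mpoly) \<Rightarrow> (nat \<Rightarrow> 'a) \<Rightarrow> (nat \<Rightarrow> 'a)"  ("\<pi>")
  where "\<pi> m F = (\<lambda>a\<in>tuples m. \<lambda>i\<in>{1..m}. meval a (F i))"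

text \<open>Only intended for finite \<open>'a\<close>; in general this is merely a monoid.\<close>

definition triangular_perm_group :: "nat \<Rightarrow> ((nat \<Rightarrow> 'a::comm_ring_1) \<Rightarrow> (nat \<Rightarrow> 'a)) monoid"
  where "triangular_perm_group m =
    (BijGroup (tuples m))\<lparr>carrier := \<pi> m ` carrier (\<M>\<T> m)\<rparr>"

end

theory Submission
  imports Defs
begin

text \<open>
  Writing \<open>f = f\<^sub>0 + (\<Sum>i. f\<^sub>i \<alpha>\<^sub>i)\<close>, one has
  \<open>f (a + (\<Sum>i. b\<^sub>i \<alpha>\<^sub>i)) = f\<^sub>0(a) + (\<Sum>i. (f\<^sub>i(a) + b\<^sub>i f\<^sub>0'(a)) \<alpha>\<^sub>i)\<close>, so \<open>f\<close> corresponds to the tuple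
  of \<open>f\<^sub>0(x\<^sub>1)\<close> and the \<open>f\<^sub>i(x\<^sub>1) + x f\<^sub>0'(x\<^sub>1)\<close> with \<open>x\<close> the variable belonging to \<open>\<alpha>\<^sub>i\<close>, compatibly
  with composition.  The point is that \<open>f\<^sub>0'\<close> is unit-valued and \<open>f\<^sub>0\<close> bijective when \<open>f\<close> is bijective,
  also over infinite rings.

  Suppose \<open>f\<^sub>0'(a)\<close> is not a unit.  Surjectivity assigns to each \<open>v \<in> R\<^sup>n\<close> a root \<open>b\<^sub>v\<close> of
  \<open>f\<^sub>0 - f\<^sub>0(a)\<close> with \<open>f\<^sub>i(b\<^sub>v) + y\<^sub>i f\<^sub>0'(b\<^sub>v) = v\<^sub>i\<close> for some \<open>y\<close>.  If \<open>v - w\<close> is unimodular, then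
  \<open>f\<^sub>0'(b\<^sub>v)\<close> and \<open>\<delta> = b\<^sub>v - b\<^sub>w\<close> are comaximal; together with
  \<open>\<delta> f\<^sub>0'(b\<^sub>v) \<in> \<delta>\<^sup>2 R\<close> (Taylor), \<open>\<delta>\<close> becomes a unit on one factor of a product decomposition of \<open>R\<close>
  and \<open>0\<close> on the other.  Where \<open>\<delta> = 0\<close>, \<open>f\<^sub>0'(b\<^sub>v)\<close> is a unit, and injectivity forces \<open>b\<^sub>v = a\<close>; so
  after passing to a factor where \<open>f\<^sub>0'(a)\<close> is still not a unit, \<open>\<delta>\<close> is a unit.  Hence a set of \<open>N\<close>
  elements with unit differences yields \<open>N\<^sup>2\<close> roots with unit differences, since \<open>n > 1\<close>.  Starting
  from \<open>{0, 1}\<close> and iterating, \<open>f\<^sub>0 - f\<^sub>0(a)\<close> gets more roots than its degree permits.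
\<close>


section \<open>Derivatives over commutative rings\<close>

text \<open>\<open>pderiv\<close> is only available in the absence of zero divisors.\<close>

definition formal_deriv :: "'a::comm_ring_1 poly \<Rightarrow> 'a poly"
  where "formal_deriv p = (\<Sum>k\<le>degree p. monom (of_nat k * coeff p k) (k - 1))"

lemma coeff_formal_deriv: "coeff (formal_deriv p) n = of_nat (Suc n) * coeff p (Suc n)"
proof -
  have "coeff (monom (of_nat k * coeff p k) (k - 1)) n =
      (if k = Suc n then of_nat k * coeff p k else 0)" for k
    by (cases k) simp_all
  then have "coeff (formal_deriv p) n = (\<Sum>k\<le>degree p. if k = Suc n then of_nat k * coeff p k else 0)"
    by (simp only: formal_deriv_def coeff_sum)
  also have "\<dots> = (if Suc n \<le> degree p then of_nat (Suc n) * coeff p (Suc n) else 0)"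
    by (subst sum.delta) simp_all
  finally show ?thesis
    by (simp add: coeff_eq_0 split: if_splits)
qed

lemma formal_deriv_0 [simp]: "formal_deriv 0 = 0"
  by (rule poly_eqI) (simp add: coeff_formal_deriv)

lemma formal_deriv_pCons: "formal_deriv (pCons a p) = p + pCons 0 (formal_deriv p)"
proof (rule poly_eqI)
  show "coeff (formal_deriv (pCons a p)) n = coeff (p + pCons 0 (formal_deriv p)) n" for n
    by (cases n) (simp_all add: coeff_formal_deriv algebra_simps)
qed

lemma formal_deriv_add: "formal_deriv (p + q) = formal_deriv p + formal_deriv q"
  by (rule poly_eqI) (simp add: coeff_formal_deriv algebra_simps)

lemma formal_deriv_smult: "formal_deriv (smult c p) = smult c (formal_deriv p)"
  by (rule poly_eqI) (simp add: coeff_formal_deriv algebra_simps)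

lemma formal_deriv_mult: "formal_deriv (p * q) = formal_deriv p * q + p * formal_deriv q"
proof (induction p)
  case (pCons a p)
  have "pCons 0 r = [:0, 1:] * r" for r :: "'a poly"
    by simp
  with pCons show ?case
    by (simp add: formal_deriv_add formal_deriv_smult formal_deriv_pCons algebra_simps)
qed simp

lemma formal_deriv_pcompose:
  "formal_deriv (pcompose p q) = pcompose (formal_deriv p) q * formal_deriv q"
  by (induction p)
    (simp_all add: pcompose_pCons pcompose_add formal_deriv_add formal_deriv_mult
      formal_deriv_pCons algebra_simps)

lemma poly_taylor2:
  fixes p :: "'a::comm_ring_1 poly"
  obtains w where "poly p y = poly p x + (y - x) * poly (formal_deriv p) x + (y - x)\<^sup>2 * w"
proof -
  have "\<exists>w. poly p y = poly p x + (y - x) * poly (formal_deriv p) x + (y - x)\<^sup>2 * w"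
  proof (induction p)
    case (pCons a p)
    then obtain w where
      w: "poly p y = poly p x + (y - x) * poly (formal_deriv p) x + (y - x)\<^sup>2 * w"
      by blast
    \<comment> \<open>Writing the new factor \<open>y\<close> as \<open>x + (y - x)\<close> moves a
      copy of the derivative at \<open>x\<close> into the quadratic remainder; \<open>y * w\<close>
      is the old remainder multiplied by \<open>y\<close>.\<close>
    show ?case
      by (intro exI [of _ "poly (formal_deriv p) x + y * w"])
        (simp add: w formal_deriv_pCons algebra_simps power2_eq_square)
  qed (auto intro: exI [of _ 0])
  then show ?thesis
    using that by blast
qed

lemma poly_diff_multiple:
  fixes p :: "'a::comm_ring_1 poly"
  obtains w where "poly p y - poly p x = (y - x) * w"
proof -
  obtain w where "poly p y = poly p x + (y - x) * poly (formal_deriv p) x + (y - x)\<^sup>2 * w"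
    by (rule poly_taylor2)
  then show ?thesis
    by (intro that [of "poly (formal_deriv p) x + (y - x) * w"])
      (simp add: algebra_simps power2_eq_square)
qed


section \<open>Units on the factor cut out by an idempotent\<close>

text \<open>For idempotent \<open>e\<close>, this is invertibility of \<open>x\<close> in the factor
  ring eR. At \<open>e = 0\<close> it always holds, so a non-unit on \<open>e\<close> certifies
  \<open>e \<noteq> 0\<close>.\<close>

definition unit_on :: "'a::comm_ring_1 \<Rightarrow> 'a \<Rightarrow> bool"
  where "unit_on e x \<longleftrightarrow> (\<exists>y. x * y * e = e)"

lemma unit_on_mono:
  assumes "unit_on e x" "\<epsilon> * e = \<epsilon>"
  shows "unit_on \<epsilon> x"
proof -
  obtain y where y: "x * y * e = e"
    using assms(1) by (auto simp: unit_on_def)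
  have "x * y * \<epsilon> = \<epsilon> * (x * y * e)"
    by (subst assms(2) [symmetric]) (simp only: ac_simps)
  then show ?thesis
    using y assms(2) by (auto simp: unit_on_def)
qed

lemma unit_on_split:
  assumes "e * e = e" "\<epsilon> * \<epsilon> = \<epsilon>" "\<epsilon> * e = \<epsilon>" "unit_on \<epsilon> x" "unit_on (e - \<epsilon>) x"
  shows "unit_on e x"
proof -
  obtain y z where y: "x * y * \<epsilon> = \<epsilon>" and z: "x * z * (e - \<epsilon>) = e - \<epsilon>"
    using assms by (auto simp: unit_on_def)
  have "x * (y * \<epsilon> + z * (e - \<epsilon>)) * e = x * y * (\<epsilon> * e) + x * z * (e * e - \<epsilon> * e)"
    by (simp add: algebra_simps)
  also have "\<dots> = e"
    using assms y z by simp
  finally show ?thesis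
    by (auto simp: unit_on_def)
qed

lemma idempotent_poly_cong:
  fixes p :: "'a::comm_ring_1 poly"
  assumes "e * x = e * y"
  shows "e * poly p x = e * poly p y"
proof -
  obtain w where w: "poly p x - poly p y = (x - y) * w"
    by (rule poly_diff_multiple)
  have "e * (poly p x - poly p y) = (e * x - e * y) * w"
    unfolding w by (simp add: algebra_simps)
  then show ?thesis
    using assms by (simp add: algebra_simps)
qed

text \<open>The usual root count, with unit differences on \<open>e\<close> replacing the absence of
  zero divisors: a linear factor is split off at one root, and the other roots remain roots of the
  quotient on that factor.\<close>

lemma poly_vanishes_if_many_roots:
  fixes p :: "'a::comm_ring_1 poly"
  assumes "finite S" "degree p < card S" "\<forall>s\<in>S. e * poly p s = 0"
    "\<forall>s\<in>S. \<forall>t\<in>S. s \<noteq> t \<longrightarrow> unit_on e (s - t)"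
  shows "smult e p = 0"
  using assms
proof (induction "card S" arbitrary: S p)
  case (Suc n)
  obtain s where s: "s \<in> S"
    using Suc.hyps(2) by fastforce
  define q where "q = synthetic_div p s"
  have p: "p = [:- s, 1:] * q + [:poly p s:]"
    unfolding q_def by (rule synthetic_div_correct' [symmetric])
  have eval: "poly p t = (t - s) * poly q t + poly p s" for t
    by (subst p) (simp add: algebra_simps)
  have es: "e * poly p s = 0"
    using Suc.prems s by blast
  \<comment> \<open>For degree 0 the quotient \<open>q\<close> still has degree 0 while
    \<open>S - {s}\<close> may be empty, so the induction hypothesis could not be applied.\<close>
  show ?case
  proof (cases "degree p = 0")
    case True
    then obtain c where "p = [:c:]"
      by (rule degree_eq_zeroE)
    then show ?thesis
      using es by simp
  next
    case False
    have "e * poly q t = 0" if t: "t \<in> S - {s}" for t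
    proof -
      obtain y where y: "(t - s) * y * e = e"
        using Suc.prems(4) s t by (auto simp: unit_on_def)
      have "e * poly q t = ((t - s) * y * e) * poly q t"
        by (simp only: y)
      also have "\<dots> = y * (e * poly p t - e * poly p s)"
        by (simp add: eval [of t] algebra_simps)
      also have "\<dots> = 0"
        using Suc.prems(3) s t by auto
      finally show ?thesis .
    qed
    moreover have "n = card (S - {s})" "finite (S - {s})"
      using Suc.hyps(2) Suc.prems(1) s by auto
    moreover have "degree q < card (S - {s})"
      using Suc.hyps(2) Suc.prems False s unfolding q_def degree_synthetic_div by simp
    ultimately have "smult e q = 0"
      using Suc.hyps(1) [of "S - {s}" q] Suc.prems(4) by blast
    then have "smult e ([:- s, 1:] * q) = 0"
      by (metis mult_smult_right mult_zero_right)
    moreover have "smult e p = smult e ([:- s, 1:] * q) + smult e [:poly p s:]"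
      by (subst p) (rule smult_add_right)
    ultimately show ?thesis
      using es by simp
  qed
qed simp


section \<open>Permutation polynomials of the dual numbers\<close>

text \<open>\<open>p\<close> and \<open>q i\<close> play the roles of f_0 and f_i;
  \<open>inj\<close> and \<open>surj\<close> are injectivity and surjectivity of f on the dual
  numbers, read in components.\<close>

context
  fixes p :: "'a::comm_ring_1 poly" and q :: "'n \<Rightarrow> 'a poly"
  assumes inj: "\<And>a b y z. poly p a = poly p b \<Longrightarrow>
      (\<And>i. poly (q i) a + y i * poly (formal_deriv p) a =
            poly (q i) b + z i * poly (formal_deriv p) b) \<Longrightarrow> a = b \<and> y = z"
    and surj: "\<And>c v. \<exists>b y. poly p b = c \<and>
      (\<forall>i. poly (q i) b + y i * poly (formal_deriv p) b = v i)"
begin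

private abbreviation (input) "d \<equiv> poly (formal_deriv p)"

text \<open>Glue \<open>b\<close> on the factor \<open>e\<close> to \<open>a\<close> on the
  complementary factor. As \<open>d b\<close> is a unit on \<open>e\<close>, the glued point can be
  given coefficients that make its image equal to that of \<open>a\<close>, and injectivity
  identifies the two.\<close>

lemma fibre_agrees_on_unit_part:
  assumes e: "e * e = e" and eq: "poly p b = poly p a" and unit: "unit_on e (d b)"
  shows "e * b = e * a"
proof -
  obtain r where r: "d b * r * e = e"
    using unit by (auto simp: unit_on_def)
  define x where "x = a + e * (b - a)"
  \<comment> \<open>Solves the coefficient equations on \<open>e\<close>, dividing by
    \<open>d b\<close> via \<open>r\<close>, and vanishes on the complement.\<close>
  define y where "y = (\<lambda>i. e * r * (poly (q i) a - poly (q i) b))"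
  have eb: "e * x = e * b"
  proof -
    have "e * x = e * a + (e * e) * (b - a)"
      by (simp add: x_def algebra_simps)
    then show ?thesis
      by (simp add: e algebra_simps)
  qed
  have ea: "(1 - e) * x = (1 - e) * a"
  proof -
    have "(1 - e) * x = (1 - e) * a + (e - e * e) * (b - a)"
      by (simp add: x_def algebra_simps)
    then show ?thesis
      by (simp add: e)
  qed
  have glue: "poly f x = e * poly f b + (1 - e) * poly f a" for f
    using idempotent_poly_cong [OF eb, of f] idempotent_poly_cong [OF ea, of f]
    by (simp add: algebra_simps)
  have "poly p x = poly p a"
    by (simp add: glue eq algebra_simps)
  moreover have "poly (q i) x + y i * d x = poly (q i) a + 0 * d a" for i
  proof -
    have "y i * d x = r * (poly (q i) a - poly (q i) b) * (e * d x)"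
      by (simp add: y_def algebra_simps)
    also have "e * d x = e * d b"
      by (rule idempotent_poly_cong [OF eb])
    also have "r * (poly (q i) a - poly (q i) b) * (e * d b)
        = (d b * r * e) * (poly (q i) a - poly (q i) b)"
      by (simp add: algebra_simps)
    also have "\<dots> = e * (poly (q i) a - poly (q i) b)"
      by (simp only: r)
    finally show ?thesis
      by (simp only: glue [of "q i"]) (simp add: algebra_simps)
  qed
  ultimately have "x = a"
    using inj [of x a y "\<lambda>_. 0"] by simp
  then show ?thesis
    using eb by simp
qed

lemma separate_on_idempotent:
  assumes e: "e * e = e" and nonunit: "\<not> unit_on e (d a)"
    and b: "poly p b = poly p a" and b': "poly p b' = poly p a"
    and comax: "(d b * r + (b - b') * s) * e = e"
  obtains \<epsilon> where "\<epsilon> * \<epsilon> = \<epsilon>" "\<epsilon> * e = \<epsilon>" "\<not> unit_on \<epsilon> (d a)" "unit_on \<epsilon> (b - b')"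
proof -
  define \<delta> where "\<delta> = b - b'"
  obtain w where "poly p b' = poly p b + (b' - b) * d b + (b' - b)\<^sup>2 * w"
    by (rule poly_taylor2)
  then have w: "\<delta> * d b = \<delta> * \<delta> * w"
    by (simp add: b b' \<delta>_def power2_eq_square algebra_simps)
  \<comment> \<open>Multiplying the comaximality relation by \<open>\<delta>\<close> and inserting
    \<open>w\<close> shows, with this \<open>t\<close>, that \<open>\<delta>\<close> is von Neumann
    regular on \<open>e\<close>.\<close>
  define t where "t = w * r + s"
  have "\<delta> * e = \<delta> * ((d b * r + \<delta> * s) * e)"
    using comax by (simp add: \<delta>_def)
  also have "\<dots> = ((\<delta> * d b) * r + \<delta> * \<delta> * s) * e"
    by (simp add: algebra_simps)
  also have "\<dots> = \<delta> * \<delta> * t * e"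
    by (simp add: w t_def algebra_simps)
  finally have \<delta>e: "\<delta> * \<delta> * t * e = \<delta> * e" ..
  \<comment> \<open>The idempotent generating the same ideal as \<open>\<delta> * e\<close>.\<close>
  define \<epsilon> where "\<epsilon> = \<delta> * t * e"
  have \<delta>\<epsilon>: "\<delta> * \<epsilon> = \<delta> * e"
    using \<delta>e by (simp add: \<epsilon>_def algebra_simps)
  have \<epsilon>e: "\<epsilon> * e = \<epsilon>"
    by (simp add: \<epsilon>_def e mult.assoc)
  have "\<epsilon> * \<epsilon> = t * e * (\<delta> * \<epsilon>)"
    by (simp add: \<epsilon>_def algebra_simps)
  also have "\<dots> = \<delta> * t * (e * e)"
    unfolding \<delta>\<epsilon> by (simp add: algebra_simps)
  finally have \<epsilon>\<epsilon>: "\<epsilon> * \<epsilon> = \<epsilon>"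
    by (simp add: e \<epsilon>_def)
  have "\<delta> * t * \<epsilon> = t * (\<delta> * \<epsilon>)"
    by (simp add: algebra_simps)
  then have unit: "unit_on \<epsilon> \<delta>"
    unfolding unit_on_def by (intro exI [of _ t]) (simp add: \<delta>\<epsilon>, simp add: \<epsilon>_def algebra_simps)
  have "\<not> unit_on \<epsilon> (d a)"
  proof
    assume \<epsilon>a: "unit_on \<epsilon> (d a)"
    \<comment> \<open>On this complement \<open>\<delta>\<close> is 0, so comaximality makes
      \<open>d b\<close> a unit and \<open>b\<close> agrees with \<open>a\<close>; then
      \<open>d a\<close> would be a unit on both pieces of \<open>e\<close>.\<close>
    define \<eta> where "\<eta> = e - \<epsilon>"
    have \<eta>: "\<eta> * \<eta> = \<eta>" "\<eta> * e = \<eta>"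
      using e \<epsilon>e \<epsilon>\<epsilon> by (simp_all add: \<eta>_def algebra_simps)
    have \<delta>\<eta>: "\<delta> * \<eta> = 0"
      by (simp add: \<eta>_def algebra_simps \<delta>\<epsilon>)
    have "\<eta> = \<eta> * ((d b * r + \<delta> * s) * e)"
      using comax \<eta>(2) by (simp add: \<delta>_def)
    also have "\<dots> = d b * r * (\<eta> * e) + (\<delta> * \<eta>) * s * e"
      by (simp add: algebra_simps)
    finally have "d b * r * \<eta> = \<eta>"
      by (simp add: \<eta> \<delta>\<eta>)
    then have r: "unit_on \<eta> (d b)"
      unfolding unit_on_def by blast
    have "\<eta> * d b = \<eta> * d a"
      using fibre_agrees_on_unit_part [OF \<eta>(1) b r] by (rule idempotent_poly_cong)
    with r have "unit_on \<eta> (d a)"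
      unfolding unit_on_def by (metis mult.assoc mult.commute)
    then show False
      using unit_on_split [OF e \<epsilon>\<epsilon> \<epsilon>e \<epsilon>a] nonunit by (simp add: \<eta>_def)
  qed
  then show ?thesis
    using that \<epsilon>\<epsilon> \<epsilon>e unit by (simp add: \<delta>_def)
qed

text \<open>The pairs are treated one at a time, each shrinking the idempotent; comaximality and the
  unit differences already obtained persist on smaller factors.\<close>

lemma separate_family_on_idempotent:
  assumes "finite M" and e: "e * e = e" and nonunit: "\<not> unit_on e (d a)"
    and roots: "\<forall>(b, b')\<in>M. poly p b = poly p a \<and> poly p b' = poly p a \<and>
      (\<exists>r s. (d b * r + (b - b') * s) * e = e)"
  shows "\<exists>\<epsilon>. \<epsilon> * \<epsilon> = \<epsilon> \<and> \<epsilon> * e = \<epsilon> \<and> \<not> unit_on \<epsilon> (d a) \<and> (\<forall>(b, b')\<in>M. unit_on \<epsilon> (b - b'))"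
  using \<open>finite M\<close> roots
proof (induction M)
  case empty
  then show ?case
    using e nonunit by blast
next
  case (insert x M)
  obtain \<epsilon> where \<epsilon>: "\<epsilon> * \<epsilon> = \<epsilon>" "\<epsilon> * e = \<epsilon>" "\<not> unit_on \<epsilon> (d a)" "\<forall>(b, b')\<in>M. unit_on \<epsilon> (b - b')"
    using insert by auto
  obtain b b' r s where x: "x = (b, b')" and bb: "poly p b = poly p a" "poly p b' = poly p a"
    and rs: "(d b * r + (b - b') * s) * e = e"
    using insert.prems by (cases x) auto
  have "(d b * r + (b - b') * s) * \<epsilon> = \<epsilon> * ((d b * r + (b - b') * s) * e)"
    by (subst \<epsilon>(2) [symmetric]) (simp only: ac_simps)
  then have rs': "(d b * r + (b - b') * s) * \<epsilon> = \<epsilon>"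
    using rs \<epsilon>(2) by simp
  obtain \<eta> where \<eta>: "\<eta> * \<eta> = \<eta>" "\<eta> * \<epsilon> = \<eta>" "\<not> unit_on \<eta> (d a)" "unit_on \<eta> (b - b')"
    using separate_on_idempotent [OF \<epsilon>(1) \<epsilon>(3) bb rs'] .
  have "\<eta> * e = \<eta>"
    using \<eta>(2) \<epsilon>(2) by (metis mult.assoc)
  moreover have "\<forall>(b, b')\<in>M. unit_on \<eta> (b - b')"
    using \<epsilon>(4) \<eta>(2) unit_on_mono by blast
  ultimately show ?case
    using \<eta> x by auto
qed

text \<open>
  The targets \<open>v\<close> supported on the coordinates \<open>i\<close> and \<open>j\<close> with values in \<open>S\<close> give a root of
  \<open>p - p(a)\<close> each, and differences of targets are unimodular; so the size of \<open>S\<close> is squared.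
\<close>

lemma square_separated_set:
  assumes ij: "(i::'n) \<noteq> j" and e: "e * e = e" and nonunit: "\<not> unit_on e (d a)"
    and fin: "finite S" and sep: "\<forall>s\<in>S. \<forall>t\<in>S. s \<noteq> t \<longrightarrow> unit_on e (s - t)"
  shows "\<exists>\<epsilon> T. \<epsilon> * \<epsilon> = \<epsilon> \<and> \<not> unit_on \<epsilon> (d a) \<and> finite T \<and> card T = card S * card S \<and>
    (\<forall>s\<in>T. poly p s = poly p a) \<and> (\<forall>s\<in>T. \<forall>t\<in>T. s \<noteq> t \<longrightarrow> unit_on \<epsilon> (s - t))"
proof -
  have "\<forall>x. \<exists>b y. poly p b = poly p a \<and>
      (\<forall>k. poly (q k) b + y k * d b = (if k = i then fst x else if k = j then snd x else 0))"
    by (intro allI surj)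
  \<comment> \<open>\<open>B x\<close> and \<open>Y x\<close> form a preimage of the target with
    constant part \<open>poly p a\<close> and coefficients given by the pair
    \<open>x\<close>.\<close>
  then obtain B Y where B: "\<And>x. poly p (B x) = poly p a" and Y: "\<And>x k.
      poly (q k) (B x) + Y x k * d (B x) = (if k = i then fst x else if k = j then snd x else 0)"
    by metis
  define M where "M = (\<lambda>(x, x'). (B x, B x')) ` {(x, x'). x \<in> S \<times> S \<and> x' \<in> S \<times> S \<and> x \<noteq> x'}"
  have comax: "\<exists>r s. (d (B x) * r + (B x - B x') * s) * e = e"
    if x: "x \<in> S \<times> S" "x' \<in> S \<times> S" "x \<noteq> x'" for x x'
  proof -
    obtain k where k: "unit_on e
        ((if k = i then fst x else if k = j then snd x else 0) -
         (if k = i then fst x' else if k = j then snd x' else 0))"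
    proof (cases "fst x = fst x'")
      case True
      then show ?thesis
        using that [of j] x sep ij by (auto simp: mem_Times_iff prod_eq_iff)
    next
      case False
      then show ?thesis
        using that [of i] x sep by (auto simp: mem_Times_iff)
    qed
    obtain u where u: "poly (q k) (B x) - poly (q k) (B x') = (B x - B x') * u"
      by (rule poly_diff_multiple)
    obtain w where w: "d (B x) - d (B x') = (B x - B x') * w"
      by (rule poly_diff_multiple)
    obtain z where z: "((poly (q k) (B x) + Y x k * d (B x)) -
        (poly (q k) (B x') + Y x' k * d (B x'))) * z * e = e"
      using k unfolding Y unit_on_def by blast
    \<comment> \<open>Modulo \<open>B x - B x'\<close> the values of \<open>q k\<close> and of
      \<open>d\<close> agree at both points, so this unit difference is a combination of
      \<open>d (B x)\<close> and \<open>B x - B x'\<close>.\<close>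
    have "(poly (q k) (B x) + Y x k * d (B x)) - (poly (q k) (B x') + Y x' k * d (B x'))
      = (poly (q k) (B x) - poly (q k) (B x')) + (Y x k - Y x' k) * d (B x)
        + Y x' k * (d (B x) - d (B x'))"
      by (simp add: algebra_simps)
    also have "\<dots> = d (B x) * (Y x k - Y x' k) + (B x - B x') * (u + Y x' k * w)"
      unfolding u w by (simp add: algebra_simps)
    finally have "(d (B x) * (Y x k - Y x' k) + (B x - B x') * (u + Y x' k * w)) * z * e = e"
      using z by simp
    then have "(d (B x) * ((Y x k - Y x' k) * z) + (B x - B x') * ((u + Y x' k * w) * z)) * e = e"
      by (simp add: algebra_simps)
    then show ?thesis
      by blast
  qed
  have "finite M"
    unfolding M_def
    by (rule finite_imageI, rule finite_subset [of _ "(S \<times> S) \<times> (S \<times> S)"]) (use fin in auto)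
  moreover have "\<forall>(b, b')\<in>M. poly p b = poly p a \<and> poly p b' = poly p a \<and>
      (\<exists>r s. (d b * r + (b - b') * s) * e = e)"
    unfolding M_def using B comax by auto
  ultimately obtain \<epsilon> where \<epsilon>: "\<epsilon> * \<epsilon> = \<epsilon>" "\<not> unit_on \<epsilon> (d a)"
    "\<forall>(b, b')\<in>M. unit_on \<epsilon> (b - b')"
    using separate_family_on_idempotent [OF _ e nonunit, of M] by blast
  have sepB: "unit_on \<epsilon> (B x - B x')" if "x \<in> S \<times> S" "x' \<in> S \<times> S" "x \<noteq> x'" for x x'
  proof -
    have "(B x, B x') \<in> M"
      unfolding M_def using that by (intro image_eqI [of _ _ "(x, x')"]) simp_all
    then show ?thesis
      using \<epsilon>(3) by fast
  qed
  \<comment> \<open>If \<open>B\<close> identified two pairs, 0 would be a unit on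
    \<open>\<epsilon>\<close>, forcing \<open>\<epsilon> = 0\<close>; so no root is counted
    twice.\<close>
  have "\<epsilon> \<noteq> 0"
    using \<epsilon>(2) by (auto simp: unit_on_def)
  then have "\<not> unit_on \<epsilon> 0"
    by (simp add: unit_on_def)
  then have "inj_on B (S \<times> S)"
    using sepB by (metis diff_self inj_onI)
  then have "card (B ` (S \<times> S)) = card S * card S"
    by (simp add: card_image card_cartesian_product)
  moreover have "\<forall>s\<in>B ` (S \<times> S). \<forall>t\<in>B ` (S \<times> S). s \<noteq> t \<longrightarrow> unit_on \<epsilon> (s - t)"
    using sepB by blast
  ultimately show ?thesis
    using \<epsilon> B fin by (intro exI [of _ \<epsilon>] exI [of _ "B ` (S \<times> S)"]) auto
qed

lemma large_separated_set:
  assumes "(i::'n) \<noteq> j" and nonunit: "\<not> unit_on 1 (d a)"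
  shows "\<exists>e S. e * e = e \<and> \<not> unit_on e (d a) \<and> finite S \<and> N + 2 \<le> card S \<and>
    (\<forall>s\<in>S. poly p s = poly p a) \<and> (\<forall>s\<in>S. \<forall>t\<in>S. s \<noteq> t \<longrightarrow> unit_on e (s - t))"
proof (induction N)
  case 0
  \<comment> \<open>0 and 1 need not be roots themselves; one squaring turns them into a separated
    set of four roots.\<close>
  have "\<forall>s\<in>{0, 1}. \<forall>t\<in>{0, 1}. s \<noteq> t \<longrightarrow> unit_on 1 (s - t :: 'a)"
    by (auto simp: unit_on_def intro: exI [of _ 1] exI [of _ "- 1"])
  from square_separated_set [OF assms(1) _ nonunit _ this] show ?case
    by fastforce
next
  case (Suc N)
  then obtain e S where eS: "e * e = e" "\<not> unit_on e (d a)" "finite S" "N + 2 \<le> card S"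
    "\<forall>s\<in>S. \<forall>t\<in>S. s \<noteq> t \<longrightarrow> unit_on e (s - t)"
    by blast
  have "2 * (N + 2) \<le> card S * card S"
    using eS(4) by (intro mult_mono) auto
  then have "Suc N + 2 \<le> card S * card S"
    by simp
  with square_separated_set [OF assms(1) eS(1,2,3,5)] show ?case
    by metis
qed

text \<open>Too many separated roots annihilate p - p(a) on a nonzero factor, whereas by
  surjectivity this polynomial takes the value 1.\<close>

lemma deriv_unit_valued:
  assumes "(i::'n) \<noteq> j"
  shows "d a dvd 1"
proof (rule ccontr)
  assume "\<not> d a dvd 1"
  then have "\<not> unit_on 1 (d a)"
    by (auto simp: unit_on_def dvd_def)
  from large_separated_set [OF assms this, of "degree p"]
  obtain e S where eS: "\<not> unit_on e (d a)" "finite S" "degree p + 2 \<le> card S"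
    "\<forall>s\<in>S. poly p s = poly p a" "\<forall>s\<in>S. \<forall>t\<in>S. s \<noteq> t \<longrightarrow> unit_on e (s - t)"
    by blast
  have "degree (p - [:poly p a:]) < card S"
    using eS(3) degree_diff_le [of p "degree p" "[:poly p a:]"] by simp
  then have zero: "smult e (p - [:poly p a:]) = 0"
    using eS by (intro poly_vanishes_if_many_roots [of S]) auto
  obtain x where "poly p x = poly p a + 1"
    using surj by blast
  then have "poly (smult e (p - [:poly p a:])) x = e"
    by simp
  then have "e = 0"
    unfolding zero by simp
  then show False
    using eS(1) by (simp add: unit_on_def)
qed

text \<open>With \<open>d\<close> unit-valued, the comparison of fibres applies to the whole ring,
  \<open>e = 1\<close>.\<close>

lemma const_part_bij:
  assumes "(i::'n) \<noteq> j"
  shows "bij (poly p)"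
proof (rule bijI)
  show "inj (poly p)"
  proof (rule injI)
    fix b a
    assume eq: "poly p b = poly p a"
    have "unit_on 1 (d b)"
      using deriv_unit_valued [OF assms, of b] by (auto simp: unit_on_def dvd_def)
    from fibre_agrees_on_unit_part [OF _ eq this] show "b = a"
      by simp
  qed
  show "surj (poly p)"
    unfolding surj_def using surj [of _ "\<lambda>_. 0"] by metis
qed

end


section \<open>Evaluation of polynomials in several variables\<close>

lemma meval_hom_superset:
  assumes "finite K" "Poly_Mapping.keys p \<subseteq> K" "h 0 = 0"
  shows "meval_hom h v p = (\<Sum>e\<in>K. h (Poly_Mapping.lookup p e) *
      (\<Prod>i\<in>Poly_Mapping.keys e. v i ^ Poly_Mapping.lookup e i))"
  unfolding meval_hom_def using assms
  by (intro sum.mono_neutral_left) (auto simp: in_keys_iff)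

text \<open>Reduces additive statements to single monomials; multiplicativity of evaluation uses it
  in both factors.\<close>

lemma poly_mapping_induct [case_names single add]:
  fixes p :: "'k \<Rightarrow>\<^sub>0 'b::monoid_add"
  assumes single: "\<And>k c. P (Poly_Mapping.single k c)"
    and add: "\<And>p q. P p \<Longrightarrow> P q \<Longrightarrow> P (p + q)"
  shows "P p"
proof (induction p rule: update_induct)
  case const
  show ?case
    using single [of undefined 0] by simp
next
  case (update f a b)
  have "Poly_Mapping.update a b f = Poly_Mapping.single a b + f"
    using update(1)
    by (intro poly_mapping_eqI)
      (auto simp: lookup_update lookup_add lookup_single in_keys_iff when_def)
  then show ?case
    using add [OF single update(3)] by simp
qed

text \<open>For \<open>h\<close> the identity this yields \<open>meval\<close>, for
  \<open>h = mConst\<close> it yields \<open>msubst\<close>.\<close>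

context
  fixes h :: "'a::comm_ring_1 \<Rightarrow> 'b::comm_ring_1"
  assumes h0: "h 0 = 0" and h1: "h 1 = 1"
    and h_add: "\<And>x y. h (x + y) = h x + h y"
    and h_mult: "\<And>x y. h (x * y) = h x * h y"
begin

lemma meval_hom_add: "meval_hom h v (p + q) = meval_hom h v p + meval_hom h v q"
proof -
  let ?K = "Poly_Mapping.keys p \<union> Poly_Mapping.keys q"
  show ?thesis
    by (subst (1 2 3) meval_hom_superset [of ?K])
      (auto simp: h0 h_add lookup_add distrib_right sum.distrib Poly_Mapping.keys_add)
qed

lemma meval_hom_single:
  "meval_hom h v (Poly_Mapping.single e c) =
    h c * (\<Prod>i\<in>Poly_Mapping.keys e. v i ^ Poly_Mapping.lookup e i)"
  by (simp add: meval_hom_def h0)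

lemma monom_eval_add:
  fixes e e' :: "nat \<Rightarrow>\<^sub>0 nat" and v :: "nat \<Rightarrow> 'b"
  shows "(\<Prod>i\<in>Poly_Mapping.keys (e + e'). v i ^ Poly_Mapping.lookup (e + e') i) =
    (\<Prod>i\<in>Poly_Mapping.keys e. v i ^ Poly_Mapping.lookup e i) *
    (\<Prod>i\<in>Poly_Mapping.keys e'. v i ^ Poly_Mapping.lookup e' i)"
proof -
  let ?K = "Poly_Mapping.keys e \<union> Poly_Mapping.keys e'"
  have *: "(\<Prod>i\<in>Poly_Mapping.keys f. v i ^ Poly_Mapping.lookup f i) =
      (\<Prod>i\<in>?K. v i ^ Poly_Mapping.lookup f i)"
    if "Poly_Mapping.keys f \<subseteq> ?K" for f
    using that by (intro prod.mono_neutral_left) (auto simp: in_keys_iff)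
  show ?thesis
    unfolding * [OF Poly_Mapping.keys_add] * [OF Un_upper1] * [OF Un_upper2]
    by (simp add: lookup_add power_add prod.distrib)
qed

lemma meval_hom_mult: "meval_hom h v (p * q) = meval_hom h v p * meval_hom h v q"
proof (induction p rule: poly_mapping_induct)
  case (single k c)
  show ?case
  proof (induction q rule: poly_mapping_induct)
    case (single k' c')
    show ?case
      by (simp add: mult_single meval_hom_single monom_eval_add h_mult)
  qed (simp add: meval_hom_add distrib_left)
qed (simp add: meval_hom_add distrib_right)

lemma meval_hom_mConst: "meval_hom h v (mConst c) = h c"
  by (simp add: mConst_def meval_hom_single)

lemma meval_hom_mVar: "meval_hom h v (mVar i) = v i"
  by (simp add: mVar_def meval_hom_single h1)

end

lemma mConst_hom:
  "mConst 0 = 0" "mConst 1 = 1"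
  "mConst (a + b) = mConst a + mConst b" "mConst (a * b) = mConst a * mConst b"
  by (simp_all add: mConst_def single_add mult_single)

lemma meval_simps:
  "meval v (p + q) = meval v p + meval v q"
  "meval v (p * q) = meval v p * meval v q"
  "meval v (mConst c) = c" "meval v (mVar i) = v i"
  by (simp_all add: meval_def meval_hom_add meval_hom_mult meval_hom_mConst meval_hom_mVar)

lemma msubst_simps:
  "msubst v (p + q) = msubst v p + msubst v q"
  "msubst v (p * q) = msubst v p * msubst v q"
  "msubst v (mConst c) = mConst c" "msubst v (mVar i) = v i"
  by (simp_all add: msubst_def meval_hom_add meval_hom_mult meval_hom_mConst meval_hom_mVar
      mConst_hom)

lemma mpolys_add: "p \<in> mpolys k \<Longrightarrow> q \<in> mpolys k \<Longrightarrow> p + q \<in> mpolys k"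
  using Poly_Mapping.keys_add [of p q] by (auto simp: mpolys_def)

lemma mpolys_mult:
  assumes "p \<in> mpolys k" "q \<in> mpolys k"
  shows "p * q \<in> mpolys k"
  unfolding mpolys_def
proof (intro CollectI ballI)
  fix e
  assume "e \<in> Poly_Mapping.keys (p * q)"
  then obtain a b where ab: "e = a + b" "a \<in> Poly_Mapping.keys p" "b \<in> Poly_Mapping.keys q"
    using Poly_Mapping.keys_mult [of p q] by blast
  then have "Poly_Mapping.keys a \<subseteq> {1..k}" "Poly_Mapping.keys b \<subseteq> {1..k}"
    using assms by (simp_all add: mpolys_def)
  then show "Poly_Mapping.keys e \<subseteq> {1..k}"
    using Poly_Mapping.keys_add [of a b] ab(1) by blast
qed

lemma mConst_in_mpolys: "mConst c \<in> mpolys k"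
  by (auto simp: mpolys_def mConst_def)

lemma mVar_in_mpolys: "i \<in> {1..k} \<Longrightarrow> mVar i \<in> mpolys k"
  by (auto simp: mpolys_def mVar_def)


section \<open>Univariate polynomials as polynomials in \<open>x\<^sub>1\<close>\<close>

definition poly_x1 :: "'a::comm_ring_1 poly \<Rightarrow> 'a mpoly"
  where "poly_x1 p = poly (map_poly mConst p) (mVar 1)"

lemma poly_x1_0 [simp]: "poly_x1 0 = 0"
  by (simp add: poly_x1_def)

lemma poly_x1_pCons: "poly_x1 (pCons a p) = mConst a + mVar 1 * poly_x1 p"
  by (simp add: poly_x1_def map_poly_pCons mConst_hom)

lemma poly_x1_const: "poly_x1 [:a:] = mConst a"
  by (simp add: poly_x1_pCons)

lemma poly_x1_add: "poly_x1 (p + q) = poly_x1 p + poly_x1 q"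
proof (induction p q rule: poly_induct2)
  case (pCons a p b q)
  then show ?case
    by (simp add: poly_x1_pCons mConst_hom algebra_simps)
qed simp

lemma poly_x1_smult: "poly_x1 (smult c p) = mConst c * poly_x1 p"
  by (induction p) (simp_all add: poly_x1_pCons mConst_hom algebra_simps)

lemma poly_x1_mult: "poly_x1 (p * q) = poly_x1 p * poly_x1 q"
  by (induction p)
    (simp_all add: poly_x1_add poly_x1_smult poly_x1_pCons mConst_hom algebra_simps)

lemma poly_x1_in_mpolys: "k \<ge> 1 \<Longrightarrow> poly_x1 p \<in> mpolys k"
proof (induction p)
  case 0
  then show ?case
    using mConst_in_mpolys [of 0] by (simp add: mConst_hom)
next
  case (pCons a p)
  then show ?case
    by (simp add: poly_x1_pCons mpolys_add mpolys_mult mConst_in_mpolys mVar_in_mpolys)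
qed

lemma meval_poly_x1: "meval v (poly_x1 p) = poly p (v 1)"
proof (induction p)
  case 0
  then show ?case
    by (simp add: meval_def meval_hom_def)
qed (simp add: poly_x1_pCons meval_simps)

lemma msubst_poly_x1:
  assumes "G 1 = poly_x1 q"
  shows "msubst G (poly_x1 p) = poly_x1 (pcompose p q)"
proof (induction p)
  case 0
  then show ?case
    by (simp add: msubst_def meval_hom_def)
qed (simp add: poly_x1_pCons msubst_simps assms [simplified] pcompose_pCons poly_x1_add poly_x1_mult
    poly_x1_const)

text \<open>Evaluation in \<open>'a poly\<close> with every variable sent to the indeterminate is a
  left inverse.\<close>

lemma inj_poly_x1: "inj poly_x1"
proof (rule inj_on_inverseI)
  fix p :: "'a poly"
  show "meval_hom (\<lambda>c. [:c:]) (\<lambda>_. [:0, 1:]) (poly_x1 p) = p"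
  proof (induction p)
    case 0
    then show ?case
      by (simp add: meval_hom_def)
  qed (simp add: poly_x1_pCons meval_hom_add meval_hom_mult meval_hom_mConst meval_hom_mVar)
qed


section \<open>Polynomials over the dual numbers\<close>

text \<open>\<open>const_poly f\<close> and \<open>coeff_poly i f\<close> are the components f_0 and
  f_i of f.\<close>

definition const_poly :: "('a::comm_ring_1, 'n) dual_number poly \<Rightarrow> 'a poly"
  where "const_poly = map_poly dual_const"

definition coeff_poly :: "'n \<Rightarrow> ('a::comm_ring_1, 'n) dual_number poly \<Rightarrow> 'a poly"
  where "coeff_poly i = map_poly (\<lambda>x. dual_coeff x i)"

lemma dual_simps [simp]:
  "dual_const (0 :: ('a::comm_ring_1, 'n) dual_number) = 0"
  "dual_coeff (0 :: ('a, 'n) dual_number) i = 0"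
  "dual_const (1 :: ('a, 'n) dual_number) = 1"
  "dual_coeff (1 :: ('a, 'n) dual_number) i = 0"
  "dual_const (x + y :: ('a, 'n) dual_number) = dual_const x + dual_const y"
  "dual_coeff (x + y :: ('a, 'n) dual_number) i = dual_coeff x i + dual_coeff y i"
  "dual_const (x * y :: ('a, 'n) dual_number) = dual_const x * dual_const y"
  "dual_coeff (x * y :: ('a, 'n) dual_number) i =
    dual_const x * dual_coeff y i + dual_coeff x i * dual_const y"
  by (simp_all add: zero_dual_number_def one_dual_number_def plus_dual_number_def
      times_dual_number_def)

lemma dual_poly_0 [simp]: "const_poly 0 = 0" "coeff_poly i 0 = 0"
  by (simp_all add: const_poly_def coeff_poly_def)

lemma dual_poly_pCons [simp]:
  "const_poly (pCons a f) = pCons (dual_const a) (const_poly f)"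
  "coeff_poly i (pCons a f) = pCons (dual_coeff a i) (coeff_poly i f)"
  by (simp_all add: const_poly_def coeff_poly_def map_poly_pCons)

lemma dual_poly_add:
  "const_poly (f + g) = const_poly f + const_poly g"
  "coeff_poly i (f + g) = coeff_poly i f + coeff_poly i g"
  by (simp_all add: const_poly_def coeff_poly_def poly_eq_iff coeff_map_poly)

lemma dual_poly_smult:
  "const_poly (smult c f) = smult (dual_const c) (const_poly f)"
  "coeff_poly i (smult c f) =
    smult (dual_const c) (coeff_poly i f) + smult (dual_coeff c i) (const_poly f)"
  by (simp_all add: const_poly_def coeff_poly_def poly_eq_iff coeff_map_poly)

lemma dual_poly_mult:
  "const_poly (f * g) = const_poly f * const_poly g"
  "coeff_poly i (f * g) = const_poly f * coeff_poly i g + coeff_poly i f * const_poly g"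
  by (induction f) (simp_all add: dual_poly_add dual_poly_smult algebra_simps)

lemma const_poly_pcompose: "const_poly (pcompose f g) = pcompose (const_poly f) (const_poly g)"
  by (induction f) (simp_all add: pcompose_pCons dual_poly_add dual_poly_mult)

text \<open>Products of the alpha_i vanish, so \<open>f\<close> is expanded around the constant part
  of \<open>g\<close> only to first order.\<close>

lemma coeff_poly_pcompose:
  "coeff_poly i (pcompose f g) = pcompose (coeff_poly i f) (const_poly g) +
    coeff_poly i g * pcompose (formal_deriv (const_poly f)) (const_poly g)"
  by (induction f)
    (simp_all add: pcompose_pCons pcompose_add dual_poly_add dual_poly_mult const_poly_pcompose
      formal_deriv_pCons algebra_simps)

lemma dual_const_poly: "dual_const (poly f x) = poly (const_poly f) (dual_const x)"
  by (induction f) simp_all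

lemma dual_coeff_poly:
  "dual_coeff (poly f x) i = poly (coeff_poly i f) (dual_const x) +
    dual_coeff x i * poly (formal_deriv (const_poly f)) (dual_const x)"
  by (induction f) (simp_all add: formal_deriv_pCons dual_const_poly algebra_simps)

lemma dual_poly_eqI:
  assumes "const_poly f = const_poly g" "\<And>i. coeff_poly i f = coeff_poly i g"
  shows "f = g"
proof (rule poly_eqI, rule dual_number.expand, intro conjI ext)
  show "dual_const (coeff f n) = dual_const (coeff g n)" for n
    using arg_cong [OF assms(1), of "\<lambda>p. coeff p n"]
    by (simp add: const_poly_def coeff_map_poly)
  show "dual_coeff (coeff f n) i = dual_coeff (coeff g n) i" for n i
    using arg_cong [OF assms(2) [of i], of "\<lambda>p. coeff p n"]
    by (simp add: coeff_poly_def coeff_map_poly)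
qed

lemma dual_perm_poly:
  fixes f :: "('a::comm_ring_1, 'n) dual_number poly"
  assumes bij: "bij (poly f)" and ij: "(i::'n) \<noteq> j"
  shows "bij (poly (const_poly f))" "poly (formal_deriv (const_poly f)) a dvd 1"
proof -
  have *: "poly f (Dual a y) = Dual (poly (const_poly f) a)
      (\<lambda>k. poly (coeff_poly k f) a + y k * poly (formal_deriv (const_poly f)) a)" for a y
    by (rule dual_number.expand) (simp add: dual_const_poly dual_coeff_poly fun_eq_iff)
  have inj: "a = b \<and> y = z"
    if "poly (const_poly f) a = poly (const_poly f) b"
      "\<And>k. poly (coeff_poly k f) a + y k * poly (formal_deriv (const_poly f)) a =
        poly (coeff_poly k f) b + z k * poly (formal_deriv (const_poly f)) b" for a b y z
    using injD [OF bij_is_inj [OF bij], of "Dual a y" "Dual b z"] that by (simp add: *)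
  have surj: "\<exists>b y. poly (const_poly f) b = c \<and>
      (\<forall>k. poly (coeff_poly k f) b + y k * poly (formal_deriv (const_poly f)) b = v k)" for c v
  proof -
    obtain x where "poly f x = Dual c v"
      using bij_is_surj [OF bij] by (metis surjD)
    then have "poly f (Dual (dual_const x) (dual_coeff x)) = Dual c v"
      by simp
    then show ?thesis
      unfolding * by (auto simp: fun_eq_iff)
  qed
  show "bij (poly (const_poly f))"
    using inj surj ij by (rule const_part_bij)
  show "poly (formal_deriv (const_poly f)) a dvd 1"
    using inj surj ij by (rule deriv_unit_valued)
qed


section \<open>The embedding\<close>

text \<open>\<open>'n\<close> carries no numbering, so \<open>idx\<close> decides which alpha
  belongs to each variable after the first; the first one stands for the constant part.\<close>

definition triangular_tuple_of ::
    "(nat \<Rightarrow> 'n) \<Rightarrow> nat \<Rightarrow> ('a::comm_ring_1, 'n) dual_number poly \<Rightarrow> nat \<Rightarrow> 'a mpoly"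
  where "triangular_tuple_of idx m f = (\<lambda>i\<in>{1..m}. if i = 1 then poly_x1 (const_poly f)
    else poly_x1 (coeff_poly (idx i) f) + mVar i * poly_x1 (formal_deriv (const_poly f)))"

lemma triangular_tuple_of_in_triangular_tuples:
  assumes bij: "bij (poly f)" and "(i::'n) \<noteq> j" and m: "1 \<le> m"
  shows "triangular_tuple_of idx m (f :: ('a::comm_ring_1, 'n) dual_number poly)
    \<in> triangular_tuples m"
proof -
  note perm = dual_perm_poly [OF bij \<open>i \<noteq> j\<close>]
  have "\<exists>g\<in>mpolys (k - 1). \<exists>u\<in>mpolys (k - 1). unit_valued (k - 1) u \<and>
      triangular_tuple_of idx m f k = g + mVar k * u" if k: "k \<in> {2..m}" for k
  proof (intro bexI conjI)
    show "triangular_tuple_of idx m f k = poly_x1 (coeff_poly (idx k) f) +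
        mVar k * poly_x1 (formal_deriv (const_poly f))"
      using k by (simp add: triangular_tuple_of_def)
    show "unit_valued (k - 1) (poly_x1 (formal_deriv (const_poly f)))"
      using perm(2) by (simp add: unit_valued_def meval_poly_x1)
  \<comment> \<open>As \<open>k\<close> is at least 2, the first variable is among the
    \<open>k - 1\<close> allowed ones.\<close>
  qed (use k in \<open>auto intro: poly_x1_in_mpolys\<close>)
  then show ?thesis
    using m perm(1)
    by (simp add: triangular_tuples_def) (simp add: triangular_tuple_of_def poly_x1_in_mpolys meval_poly_x1)
qed

text \<open>Substituting into f_i + x_i f_0' gives x_i the coefficient f_0'(g_0) g_0', which is the
  chain rule; the terms free of x_i are those of \<open>coeff_poly_pcompose\<close>.\<close>

lemma triangular_tuple_of_pcompose:
  assumes m: "1 \<le> m"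
  shows "triangular_tuple_of idx m (pcompose f g) =
    (\<lambda>i\<in>{1..m}. msubst (triangular_tuple_of idx m g) (triangular_tuple_of idx m f i))"
proof -
  let ?G = "triangular_tuple_of idx m g"
  have G1: "?G 1 = poly_x1 (const_poly g)"
    using m by (simp add: triangular_tuple_of_def)
  note sub = msubst_poly_x1 [of ?G, OF G1]
  have "triangular_tuple_of idx m (pcompose f g) i = msubst ?G (triangular_tuple_of idx m f i)"
    if i: "i \<in> {1..m}" for i
  proof (cases "i = 1")
    case True
    then show ?thesis
      using m by (subst (1 3) triangular_tuple_of_def) (simp add: sub const_poly_pcompose)
  next
    case False
    then have "?G i = poly_x1 (coeff_poly (idx i) g) +
        mVar i * poly_x1 (formal_deriv (const_poly g))"
      using i by (simp add: triangular_tuple_of_def)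
    then show ?thesis
      using i False
      by (subst (1 3) triangular_tuple_of_def)
        (simp add: sub msubst_simps const_poly_pcompose coeff_poly_pcompose formal_deriv_pcompose
          poly_x1_add poly_x1_mult algebra_simps)
  qed
  then show ?thesis
    by (intro extensionalityI [of _ "{1..m}"]) (simp_all add: triangular_tuple_of_def [of _ _ "pcompose f g"])
qed

lemma triangular_tuple_of_id: "triangular_tuple_of idx m [:0, 1:] = (\<lambda>i\<in>{1..m}. mVar i)"
  by (auto simp: triangular_tuple_of_def fun_eq_iff poly_x1_pCons mConst_hom formal_deriv_pCons
      restrict_def)

text \<open>The first entry determines f_0, hence also the derivative terms; cancelling these leaves
  every f_i, as \<open>idx\<close> is onto.\<close>

lemma inj_triangular_tuple_of:
  assumes idx: "idx ` {2..m} = UNIV" and m: "1 \<le> m"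
  shows "inj (triangular_tuple_of idx m :: ('a::comm_ring_1, 'n) dual_number poly \<Rightarrow> _)"
proof (rule injI)
  fix f g :: "('a, 'n) dual_number poly"
  assume eq: "triangular_tuple_of idx m f = triangular_tuple_of idx m g"
  have const: "const_poly f = const_poly g"
    using fun_cong [OF eq, of 1] m
    by (simp add: triangular_tuple_of_def inj_eq [OF inj_poly_x1])
  moreover have "coeff_poly k f = coeff_poly k g" for k
  proof -
    obtain i where "i \<in> {2..m}" "idx i = k"
      using idx by (metis UNIV_I imageE)
    then show ?thesis
      using fun_cong [OF eq, of i] const
      by (simp add: triangular_tuple_of_def inj_eq [OF inj_poly_x1])
  qed
  ultimately show "f = g"
    by (rule dual_poly_eqI)
qed

section \<open>Permutations of the dual numbers as permutations of tuples\<close>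

definition tuple_of_dual :: "(nat \<Rightarrow> 'n) \<Rightarrow> nat \<Rightarrow> ('a, 'n) dual_number \<Rightarrow> nat \<Rightarrow> 'a"
  where "tuple_of_dual idx m x =
    (\<lambda>i\<in>{1..m}. if i = 1 then dual_const x else dual_coeff x (idx i))"

lemma bij_tuple_of_dual:
  assumes idx: "bij_betw idx {2..m} UNIV" and m: "1 \<le> m"
  shows "bij_betw (tuple_of_dual idx m) UNIV (tuples m)"
proof (rule bij_betw_byWitness
    [of _ "\<lambda>t. Dual (t 1) (\<lambda>k. t (inv_into {2..m} idx k))"])
  have "k \<in> idx ` {2..m}" for k
    using idx by (simp add: bij_betw_def)
  then have inv: "inv_into {2..m} idx k \<in> {2..m}" "idx (inv_into {2..m} idx k) = k" for k
    using inv_into_into [of k idx "{2..m}"] f_inv_into_f [of k idx "{2..m}"] by blast+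
  show "\<forall>x\<in>UNIV. Dual (tuple_of_dual idx m x 1)
      (\<lambda>k. tuple_of_dual idx m x (inv_into {2..m} idx k)) = x"
  proof
    fix x
    have "tuple_of_dual idx m x (inv_into {2..m} idx k) = dual_coeff x k" for k
      using inv [of k] by (auto simp: tuple_of_dual_def)
    then show "Dual (tuple_of_dual idx m x 1)
        (\<lambda>k. tuple_of_dual idx m x (inv_into {2..m} idx k)) = x"
      using m by (simp add: tuple_of_dual_def)
  qed
  show "\<forall>t\<in>tuples m. tuple_of_dual idx m (Dual (t 1) (\<lambda>k. t (inv_into {2..m} idx k))) = t"
  proof (intro ballI ext)
    fix t i
    assume "t \<in> tuples m"
    then show "tuple_of_dual idx m (Dual (t 1) (\<lambda>k. t (inv_into {2..m} idx k))) i = t i"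
      using inv_into_f_f [OF bij_betw_imp_inj_on [OF idx], of i]
      by (auto simp: tuple_of_dual_def tuples_def PiE_iff extensional_def restrict_def)
  qed
qed (auto simp: tuple_of_dual_def tuples_def)

text \<open>Once \<open>tuple_of_dual\<close> is a bijection onto the tuples, this makes the induced
  map depend only on the function \<open>poly f\<close>.\<close>

lemma induced_map_triangular_tuple_of:
  assumes "1 \<le> m"
  shows "\<pi> m (triangular_tuple_of idx m f) (tuple_of_dual idx m x) = tuple_of_dual idx m (poly f x)"
proof -
  have "tuple_of_dual idx m x \<in> tuples m"
    by (simp add: tuple_of_dual_def tuples_def)
  then show ?thesis
    using assms
    by (auto simp: induced_map_def triangular_tuple_of_def meval_simps meval_poly_x1
        tuple_of_dual_def dual_const_poly dual_coeff_poly restrict_def fun_eq_iff)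
qed

text \<open>Transporting permutations along \<open>tuple_of_dual\<close> makes the second embedding automatic.\<close>

lemma conjugation_in_Bij:
  assumes "bij_betw \<tau> A B" "bij_betw \<sigma> A A"
  shows "(\<lambda>t\<in>B. \<tau> (\<sigma> (inv_into A \<tau> t))) \<in> Bij B"
proof -
  have "bij_betw (\<tau> \<circ> (\<sigma> \<circ> inv_into A \<tau>)) B B"
    using assms by (intro bij_betw_trans [of _ B A] bij_betw_inv_into)
  then show ?thesis
    by (simp add: Bij_def bij_betw_def inj_on_def image_def)
qed

theorem proposition5p4:
  assumes "CARD('n::finite) > 1"
  shows
    "(\<exists>\<phi> \<in> mon (\<M>\<P> :: ('a::comm_ring_1, 'n) dual_number poly monoid)
                (\<M>\<T> (CARD('n) + 1) :: (nat \<Rightarrow> 'a mpoly) monoid).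
        \<phi> \<one>\<^bsub>\<M>\<P>\<^esub> = \<one>\<^bsub>\<M>\<T> (CARD('n) + 1)\<^esub>) \<and>
     (finite (UNIV :: 'a set) \<longrightarrow>
       (\<exists>\<psi>. \<psi> \<in> mon (\<P> :: (('a, 'n) dual_number \<Rightarrow> ('a, 'n) dual_number) monoid)
                   (triangular_perm_group (CARD('n) + 1) ::
                      ((nat \<Rightarrow> 'a) \<Rightarrow> (nat \<Rightarrow> 'a)) monoid)))"
proof -
  define m where "m = CARD('n) + 1"
  have m: "1 \<le> m"
    by (simp add: m_def)
  obtain i j :: 'n where ij: "i \<noteq> j"
    using assms by (metis One_nat_def card_1_singleton_iff card_le_Suc0_iff_eq finite leD UNIV_I)
  obtain idx :: "nat \<Rightarrow> 'n" where idx: "bij_betw idx {2..m} UNIV"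
    using finite_same_card_bij [of "{2..m}" "UNIV :: 'n set"] by (auto simp: m_def)
  define \<phi> where
    "\<phi> = (triangular_tuple_of idx m :: ('a, 'n) dual_number poly \<Rightarrow> nat \<Rightarrow> 'a mpoly)"
  have tri: "\<phi> f \<in> triangular_tuples m" if "bij (poly f)" for f
    unfolding \<phi>_def using that ij m by (rule triangular_tuple_of_in_triangular_tuples)
  have "\<phi> \<in> mon \<M>\<P> (\<M>\<T> m)"
    unfolding mon_def hom_def
    using tri inj_triangular_tuple_of [OF bij_betw_imp_surj_on [OF idx] m, where 'a = 'a]
    by (auto simp: perm_poly_monoid_def triangular_monoid_def \<phi>_def inj_on_def
        triangular_tuple_of_pcompose [OF m])
  moreover have "\<phi> \<one>\<^bsub>\<M>\<P>\<^esub> = \<one>\<^bsub>\<M>\<T> m\<^esub>"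
    by (simp add: perm_poly_monoid_def triangular_monoid_def \<phi>_def triangular_tuple_of_id)
  moreover have "\<exists>\<psi>. \<psi> \<in> mon (\<P> :: (('a, 'n) dual_number \<Rightarrow> ('a, 'n) dual_number) monoid)
      (triangular_perm_group m :: ((nat \<Rightarrow> 'a) \<Rightarrow> (nat \<Rightarrow> 'a)) monoid)"
  proof
    define \<tau> where "\<tau> = (tuple_of_dual idx m :: ('a, 'n) dual_number \<Rightarrow> nat \<Rightarrow> 'a)"
    have \<tau>: "bij_betw \<tau> UNIV (tuples m)"
      unfolding \<tau>_def using idx m by (rule bij_tuple_of_dual)
    have inv_\<tau>: "inv_into UNIV \<tau> (\<tau> x) = x" "\<tau> x \<in> tuples m" for x
      using \<tau> by (auto simp: bij_betw_def)
    have \<tau>_inv: "\<tau> (inv_into UNIV \<tau> t) = t" if "t \<in> tuples m" for t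
      using \<tau> that by (auto simp: bij_betw_def f_inv_into_f)
    \<comment> \<open>Conjugation is defined on functions, so no polynomial representing
      \<open>\<sigma>\<close> has to be chosen.\<close>
    define \<psi> where "\<psi> \<sigma> = (\<lambda>t\<in>tuples m. \<tau> (\<sigma> (inv_into UNIV \<tau> t)))" for \<sigma>
    have Bij: "\<psi> \<sigma> \<in> Bij (tuples m)" if "bij \<sigma>" for \<sigma>
      unfolding \<psi>_def using \<tau> that by (rule conjugation_in_Bij)
    have "\<psi> (poly f) = \<pi> m (\<phi> f)" for f
    proof
      fix t
      show "\<psi> (poly f) t = \<pi> m (\<phi> f) t"
      proof (cases "t \<in> tuples m")
        case True
        then have "\<pi> m (\<phi> f) t = \<tau> (poly f (inv_into UNIV \<tau> t))"
          using induced_map_triangular_tuple_of [OF m, of idx f "inv_into UNIV \<tau> t"] \<tau>_inv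
          by (simp add: \<phi>_def \<tau>_def)
        then show ?thesis
          using True by (simp add: \<psi>_def)
      qed (simp add: \<psi>_def induced_map_def)
    qed
    then have "\<psi> \<in> carrier \<P> \<rightarrow> carrier (triangular_perm_group m)"
      using tri by (auto simp: poly_perm_group_def triangular_perm_group_def triangular_monoid_def)
    moreover have "\<psi> (\<sigma> \<otimes>\<^bsub>\<P>\<^esub> \<rho>) = \<psi> \<sigma> \<otimes>\<^bsub>triangular_perm_group m\<^esub> \<psi> \<rho>"
      if "\<sigma> \<in> carrier \<P>" "\<rho> \<in> carrier \<P>" for \<sigma> \<rho>
    proof -
      have bij: "bij \<sigma>" "bij \<rho>"
        using that by (auto simp: poly_perm_group_def)
      then have "\<sigma> \<otimes>\<^bsub>\<P>\<^esub> \<rho> = \<sigma> \<circ> \<rho>"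
        by (simp add: poly_perm_group_def BijGroup_def Bij_def compose_def comp_def restrict_def)
      \<comment> \<open>\<open>BijGroup\<close> multiplies by \<open>compose\<close> only on members
        of \<open>Bij\<close>, hence the appeal to \<open>Bij\<close>.\<close>
      moreover have "\<psi> \<sigma> \<otimes>\<^bsub>triangular_perm_group m\<^esub> \<psi> \<rho> = compose (tuples m) (\<psi> \<sigma>) (\<psi> \<rho>)"
        using Bij bij by (simp add: triangular_perm_group_def BijGroup_def)
      moreover have "compose (tuples m) (\<psi> \<sigma>) (\<psi> \<rho>) = \<psi> (\<sigma> \<circ> \<rho>)"
        by (auto simp: compose_def \<psi>_def inv_\<tau> fun_eq_iff restrict_def)
      ultimately show ?thesis
        by simp
    qed
    moreover have "inj \<psi>"
    proof (intro injI ext)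
      fix \<sigma> \<rho> x
      assume "\<psi> \<sigma> = \<psi> \<rho>"
      from fun_cong [OF this, of "\<tau> x"] show "\<sigma> x = \<rho> x"
        using \<tau> by (simp add: \<psi>_def inv_\<tau> inj_eq bij_betw_def)
    qed
    ultimately show "\<psi> \<in> mon \<P> (triangular_perm_group m)"
      unfolding mon_def hom_def by (auto simp: inj_on_def)
  qed
  ultimately show ?thesis
    unfolding m_def by blast
qed

end
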